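(* Let $X,Y,X_h,\widehat X$, the quadratic function $N:X\to Y^*$ with trilinear part $\Gamma$, and $Q\in L(X_h;X)$ with constant $\Lambda_4$ be as in the context, and let $u\in X$ be a regular solution to $N(u)=0$ with inf-sup constant $\beta>0$. Then any $v_h\in X_h$ with $\|u-Qv_h\|_X<\beta/\|\Gamma\|$ satisfies $$\|u-v_h\|_{\widehat X}\le\frac{\|N(Qv_h)\|_{Y^*}}{\beta-\|\Gamma\|\,\|u-Qv_h\|_X}+\|Qv_h-v_h\|_{\widehat X},$$ $$\|Qv_h-v_h\|_{\widehat X}\le\Lambda_4\|u-v_h\|_{\widehat X},$$ $$\|N(Qv_h)\|_{Y^*}\le(1+\Lambda_4)\big(\|DN(u)\|+\beta\big)\|u-v_h\|_{\widehat X}.$$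
   Context: $\widehat X$ is a real Banach space with complete linear subspaces $X$ and $X_h$ endowed with the inherited norms; $Y$ is a real Banach space. $N:X\to Y^*$ has the form $N(x):=Ax-F+\Gamma(x,x,\bullet)$ with $A\in L(X;Y^* )$, $F\in Y^*$, and a bounded trilinear form $\Gamma:X\times X\times Y\to\mathbb R$ with bound $\|\Gamma\|$ (nonzero; otherwise $N$ is affine). A regular solution is $u\in X$ with $N(u)=0$ such that the derivative $DN(u)\in L(X;Y^* )$, $DN(u;x,y)=\langle Ax,y\rangle+\Gamma(u,x,y)+\Gamma(x,u,y)$, is invertible; then $$0<\beta:=\inf_{x\in X,\ \|x\|_X=1}\ \sup_{y\in Y,\ \|y\|_Y=1}DN(u;x,y),$$ and $\|DN(u)\|$ is its norm in $L(X;Y^* )$. The operator $Q\in L(X_h;X)$ and $0\le\Lambda_4<\infty$ satisfy $\|(1-Q)x_h\|_{\widehat X}\le\Lambda_4\,\mathrm{dist}_{\|\bullet\|_{\widehat X}}(x_h,X)$ for all $x_h\in X_h$. *)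

theory Defs
  imports "HOL-Analysis.Analysis"
begin

(* The spaces X and X_h are subspaces of one ambient Banach space (a type), hence sets.
   Operators on them are total functions of which only the values on the subspace matter;
   all notions below are relativised accordingly.  The dual Y* is the type of bounded
   linear functionals, "'y \<Rightarrow>\<^sub>L real", with its operator norm. *)

definition linear_on :: "'a::real_vector set \<Rightarrow> ('a \<Rightarrow> 'b::real_vector) \<Rightarrow> bool" where
  "linear_on S f \<longleftrightarrow>
     (\<forall>x\<in>S. \<forall>y\<in>S. f (x + y) = f x + f y) \<and> (\<forall>c. \<forall>x\<in>S. f (c *\<^sub>R x) = c *\<^sub>R f x)"

definition bounded_linear_on ::
    "'a::real_normed_vector set \<Rightarrow> ('a \<Rightarrow> 'b::real_normed_vector) \<Rightarrow> bool" where
  "bounded_linear_on S f \<longleftrightarrow> linear_on S f \<and> (\<exists>K. \<forall>x\<in>S. norm (f x) \<le> K * norm x)"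

(* Operator norm on L(S;B): the relativised form of onorm.  At x = 0 the quotient is 0. *)
definition onorm_on ::
    "'a::real_normed_vector set \<Rightarrow> ('a \<Rightarrow> 'b::real_normed_vector) \<Rightarrow> real" where
  "onorm_on S f = (SUP x\<in>S. norm (f x) / norm x)"

(* Invertible in L(S;B): f is a bounded linear bijection from S onto B with bounded inverse. *)
definition invertible_on ::
    "'a::real_normed_vector set \<Rightarrow> ('a \<Rightarrow> 'b::real_normed_vector) \<Rightarrow> bool" where
  "invertible_on S f \<longleftrightarrow> bounded_linear_on S f \<and>
     (\<exists>g. bounded_linear g \<and> range g \<subseteq> S \<and> (\<forall>x\<in>S. g (f x) = x) \<and> (\<forall>b. f (g b) = b))"

(* Bounded trilinear forms on X x X x Y. *)
definition bounded_trilinear_form ::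
    "'a::real_normed_vector set \<Rightarrow> ('a \<Rightarrow> 'a \<Rightarrow> 'y::real_normed_vector \<Rightarrow> real) \<Rightarrow> bool" where
  "bounded_trilinear_form X \<Gamma> \<longleftrightarrow>
     (\<forall>w\<in>X. \<forall>y. linear_on X (\<lambda>x. \<Gamma> x w y)) \<and>
     (\<forall>x\<in>X. \<forall>y. linear_on X (\<lambda>w. \<Gamma> x w y)) \<and>
     (\<forall>x\<in>X. \<forall>w\<in>X. linear_on UNIV (\<Gamma> x w)) \<and>
     (\<exists>K. \<forall>x\<in>X. \<forall>w\<in>X. \<forall>y. \<bar>\<Gamma> x w y\<bar> \<le> K * norm x * norm w * norm y)"

definition trilinear_norm ::
    "'a::real_normed_vector set \<Rightarrow> ('a \<Rightarrow> 'a \<Rightarrow> 'y::real_normed_vector \<Rightarrow> real) \<Rightarrow> real" where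
  "trilinear_norm X \<Gamma> =
     (SUP (x, w, y)\<in>X \<times> X \<times> UNIV. \<bar>\<Gamma> x w y\<bar> / (norm x * norm w * norm y))"

(* For x, w in X and a bounded trilinear form, Blinfun (\<Gamma> x w) is the functional
   y |-> \<Gamma> x w y in Y*. *)
definition quad_map ::
    "('a::real_normed_vector \<Rightarrow> ('y::real_normed_vector \<Rightarrow>\<^sub>L real)) \<Rightarrow> ('y \<Rightarrow>\<^sub>L real) \<Rightarrow>
     ('a \<Rightarrow> 'a \<Rightarrow> 'y \<Rightarrow> real) \<Rightarrow> 'a \<Rightarrow> ('y \<Rightarrow>\<^sub>L real)" where
  "quad_map A F \<Gamma> x = A x - F + Blinfun (\<Gamma> x x)"

definition quad_deriv ::
    "('a::real_normed_vector \<Rightarrow> ('y::real_normed_vector \<Rightarrow>\<^sub>L real)) \<Rightarrow>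
     ('a \<Rightarrow> 'a \<Rightarrow> 'y \<Rightarrow> real) \<Rightarrow> 'a \<Rightarrow> 'a \<Rightarrow> ('y \<Rightarrow>\<^sub>L real)" where
  "quad_deriv A \<Gamma> u x = A x + Blinfun (\<Gamma> u x) + Blinfun (\<Gamma> x u)"

definition regular_solution ::
    "'a::real_normed_vector set \<Rightarrow> ('a \<Rightarrow> ('y::real_normed_vector \<Rightarrow>\<^sub>L real)) \<Rightarrow>
     ('y \<Rightarrow>\<^sub>L real) \<Rightarrow> ('a \<Rightarrow> 'a \<Rightarrow> 'y \<Rightarrow> real) \<Rightarrow> 'a \<Rightarrow> bool" where
  "regular_solution X A F \<Gamma> u \<longleftrightarrow>
     u \<in> X \<and> quad_map A F \<Gamma> u = 0 \<and> invertible_on X (quad_deriv A \<Gamma> u)"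

definition inf_sup_const ::
    "'a::real_normed_vector set \<Rightarrow> ('a \<Rightarrow> ('y::real_normed_vector \<Rightarrow>\<^sub>L real)) \<Rightarrow> real" where
  "inf_sup_const X D =
     (INF x\<in>{x \<in> X. norm x = 1}. SUP y\<in>{y. norm y = 1}. blinfun_apply (D x) y)"

lemma blinfun_apply_form:
  assumes "bounded_trilinear_form X \<Gamma>" "x \<in> X" "w \<in> X"
  shows "blinfun_apply (Blinfun (\<Gamma> x w)) = \<Gamma> x w"
proof -
  obtain K where K: "\<And>y. \<bar>\<Gamma> x w y\<bar> \<le> K * norm x * norm w * norm y"
    using assms unfolding bounded_trilinear_form_def by blast
  have "linear_on UNIV (\<Gamma> x w)" using assms unfolding bounded_trilinear_form_def by blast
  then have "bounded_linear (\<Gamma> x w)"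
    using K by (intro bounded_linear_intro[where K="K * norm x * norm w"])
      (auto simp: linear_on_def mult_ac)
  then show ?thesis by (rule bounded_linear_Blinfun_apply)
qed

lemma quad_deriv_apply:
  assumes "bounded_trilinear_form X \<Gamma>" "u \<in> X" "x \<in> X"
  shows "blinfun_apply (quad_deriv A \<Gamma> u x) y = blinfun_apply (A x) y + \<Gamma> u x y + \<Gamma> x u y"
  using assms by (simp add: quad_deriv_def blinfun_apply_form plus_blinfun.rep_eq)

lemma quad_map_expansion:
  assumes X: "subspace X" and A: "linear_on X A" and G: "bounded_trilinear_form X \<Gamma>"
    and u: "u \<in> X" and h: "h \<in> X"
  shows "quad_map A F \<Gamma> (u + h) =
    quad_map A F \<Gamma> u + quad_deriv A \<Gamma> u h + Blinfun (\<Gamma> h h)"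
proof -
  have uh: "u + h \<in> X" using X u h by (rule subspace_add)
  have 1: "\<Gamma> (u+h) w y = \<Gamma> u w y + \<Gamma> h w y" if "w \<in> X" for w y
    using G u h that unfolding bounded_trilinear_form_def linear_on_def by blast
  have 2: "\<Gamma> w (u+h) y = \<Gamma> w u y + \<Gamma> w h y" if "w \<in> X" for w y
    using G u h that unfolding bounded_trilinear_form_def linear_on_def by blast
  have 3: "A (u+h) = A u + A h" using A u h by (auto simp: linear_on_def)
  show ?thesis
    by (rule blinfun_eqI)
      (simp add: quad_map_def quad_deriv_def blinfun_apply_form[OF G] u h uh 1 2 3 blinfun.bilinear_simps)
qed

(* quad_deriv is the Frechet derivative of quad_map relative to X.  (has_derivative is not
   applicable, as it asks for a linear map on the whole ambient space.) *)
lemma quad_deriv_frechet: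
  fixes \<Gamma> :: "'a::real_normed_vector \<Rightarrow> 'a \<Rightarrow> 'y::real_normed_vector \<Rightarrow> real"
  assumes X: "subspace X" and A: "linear_on X A" and G: "bounded_trilinear_form X \<Gamma>"
    and u: "u \<in> X"
  shows "((\<lambda>h. norm (quad_map A F \<Gamma> (u + h) - quad_map A F \<Gamma> u - quad_deriv A \<Gamma> u h)
             / norm h) \<longlongrightarrow> 0) (at 0 within X)"
proof -
  obtain K where K: "\<And>x w (y::'y). x \<in> X \<Longrightarrow> w \<in> X \<Longrightarrow> \<bar>\<Gamma> x w y\<bar> \<le> K * norm x * norm w * norm y"
    using G unfolding bounded_trilinear_form_def by blast
  have b: "norm (Blinfun (\<Gamma> h h)) \<le> \<bar>K\<bar> * norm h * norm h" if "h \<in> X" for h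
  proof (rule norm_blinfun_bound)
    fix y :: 'y
    have "K * norm h * norm h * norm y \<le> \<bar>K\<bar> * norm h * norm h * norm y"
      by (intro mult_right_mono) auto
    then show "norm (blinfun_apply (Blinfun (\<Gamma> h h)) y) \<le> \<bar>K\<bar> * norm h * norm h * norm y"
      using K[OF that that, of y] by (simp add: blinfun_apply_form[OF G that that])
  qed simp
  have l: "((\<lambda>h. \<bar>K\<bar> * norm h) \<longlongrightarrow> 0) (at 0 within X)"
    by (auto intro!: tendsto_eq_intros)
  show ?thesis
  proof (rule tendsto_sandwich[OF _ _ tendsto_const l])
    show "eventually (\<lambda>h. norm (quad_map A F \<Gamma> (u + h) - quad_map A F \<Gamma> u - quad_deriv A \<Gamma> u h)
             / norm h \<le> \<bar>K\<bar> * norm h) (at 0 within X)"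
      using b by (auto simp: eventually_at_filter quad_map_expansion[OF X A G u] divide_simps mult_ac)
  qed simp
qed

(* In a regular solution the inf-sup constant is automatically positive.  The nonzero norm of
   \<Gamma> only serves to exclude X = {0} and Y = {0}, where the unit spheres are empty. *)
lemma regular_solution_inf_sup_pos:
  fixes \<Gamma> :: "'a::real_normed_vector \<Rightarrow> 'a \<Rightarrow> 'y::real_normed_vector \<Rightarrow> real"
  assumes X: "subspace X" and reg: "regular_solution X A F \<Gamma> u" and G: "trilinear_norm X \<Gamma> \<noteq> 0"
  shows "0 < inf_sup_const X (quad_deriv A \<Gamma> u)"
proof -
  define D where "D = quad_deriv A \<Gamma> u"
  have "\<exists>x w y. x \<in> X \<and> \<bar>\<Gamma> x w y\<bar> / (norm x * norm w * norm y) \<noteq> 0"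
  proof (rule ccontr)
    assume "\<not> ?thesis"
    then have "(\<lambda>(x, w, y). \<bar>\<Gamma> x w y\<bar> / (norm x * norm w * norm y)) ` (X \<times> X \<times> UNIV)
        = (\<lambda>_. 0) ` (X \<times> X \<times> (UNIV :: 'y set))"
      by (intro image_cong) auto
    also have "\<dots> = {0}" using subspace_0[OF X] by auto
    finally show False using G unfolding trilinear_norm_def by simp
  qed
  then obtain x0 and y0 :: 'y where x0: "x0 \<in> X" "x0 \<noteq> 0" and y0: "y0 \<noteq> 0" by fastforce
  have nx: "(1 / norm x0) *\<^sub>R x0 \<in> {x \<in> X. norm x = 1}"
    using x0 X by (auto intro: subspace_scale)
  have ny: "(1 / norm y0) *\<^sub>R y0 \<in> {y. norm y = 1}" using y0 by simp
  obtain g where g: "bounded_linear g" "\<And>x. x \<in> X \<Longrightarrow> g (D x) = x"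
    using reg unfolding regular_solution_def invertible_on_def D_def by blast
  obtain K where K: "K > 0" "\<And>b. norm (g b) \<le> norm b * K"
    using bounded_linear.pos_bounded[OF g(1)] by blast
  have "1 / K \<le> (SUP y\<in>{y. norm y = 1}. blinfun_apply (D x) y)"
    if x: "x \<in> {x \<in> X. norm x = 1}" for x
  proof -
    define s where "s = (SUP y\<in>{y. norm y = 1}. blinfun_apply (D x) y)"
    have bdd: "bdd_above (blinfun_apply (D x) ` {y. norm y = 1})"
    proof (rule bdd_aboveI2)
      fix y :: 'y assume "y \<in> {y. norm y = 1}"
      then show "blinfun_apply (D x) y \<le> norm (D x)" using norm_blinfun[of "D x" y] by auto
    qed
    have up: "blinfun_apply (D x) y \<le> s" if "norm y = 1" for y
      unfolding s_def using bdd that by (intro cSUP_upper) auto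
    have ab: "\<bar>blinfun_apply (D x) y\<bar> \<le> s" if "norm y = 1" for y
      using up[OF that] up[of "- y"] that by (simp add: blinfun.minus_right)
    have "norm (D x) \<le> s"
    proof (rule norm_blinfun_bound)
      show "0 \<le> s" using ab[of "(1 / norm y0) *\<^sub>R y0"] ny by auto
    next
      fix y :: 'y
      show "norm (blinfun_apply (D x) y) \<le> s * norm y"
      proof (cases "y = 0")
        case False
        then show ?thesis using ab[of "(1 / norm y) *\<^sub>R y"]
          by (simp add: blinfun.scaleR_right abs_mult divide_simps)
      qed simp
    qed
    moreover have "1 \<le> norm (D x) * K" using K(2)[of "D x"] g(2) x by simp
    then have "1 / K \<le> norm (D x)" using K(1) by (simp add: divide_simps)
    ultimately show ?thesis by (simp add: s_def)
  qed
  then have "1 / K \<le> inf_sup_const X D"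
    unfolding inf_sup_const_def using nx by (intro cINF_greatest) blast+
  then show ?thesis using K(1) unfolding D_def by (smt (verit) divide_pos_pos)
qed

end

theory Submission
  imports Defs
begin

text \<open>
  With \<open>e = Q v\<^sub>h - u\<close> in \<open>X\<close>, the quadratic map satisfies exactly
  \<open>N (Q v\<^sub>h) = DN(u) e + \<Gamma>(e, e, \<bullet>)\<close>. The inf-sup condition bounds \<open>DN(u) e\<close> from below by
  \<open>\<beta> \<parallel>e\<parallel>\<close>, which gives \<open>\<parallel>e\<parallel> (\<beta> - \<parallel>\<Gamma>\<parallel> \<parallel>e\<parallel>) \<le> \<parallel>N (Q v\<^sub>h)\<parallel>\<close>; the upper bounds, with
  \<open>\<parallel>\<Gamma>\<parallel> \<parallel>e\<parallel> < \<beta>\<close>, give \<open>\<parallel>N (Q v\<^sub>h)\<parallel> \<le> (\<parallel>DN(u)\<parallel> + \<beta>) \<parallel>e\<parallel>\<close>. The rest is the triangle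
  inequality and \<open>dist(v\<^sub>h, X) \<le> \<parallel>u - v\<^sub>h\<parallel>\<close>.
\<close>

text \<open>A real supremum dominates its members only over a set bounded above; the constant from
  \<open>bounded_linear_on\<close> provides that.\<close>

lemma onorm_on_upper:
  assumes f: "bounded_linear_on S f" and x: "x \<in> S"
  shows "norm (f x) / norm x \<le> onorm_on S f"
proof -
  obtain K where K: "\<And>x. x \<in> S \<Longrightarrow> norm (f x) \<le> K * norm x"
    using f unfolding bounded_linear_on_def by blast
  have "bdd_above ((\<lambda>x. norm (f x) / norm x) ` S)"
  proof (rule bdd_aboveI2)
    fix x assume "x \<in> S"
    have "norm (f x) / norm x \<le> K" if "x \<noteq> 0"
      using K[OF \<open>x \<in> S\<close>] that by (simp add: pos_divide_le_eq)
    \<comment> \<open>The quotient at \<open>0\<close> is \<open>0\<close> by the convention for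
      division, while \<open>K\<close> may be negative if \<open>S\<close> contains only
      \<open>0\<close>; hence \<open>\<bar>K\<bar>\<close>.\<close>
    then show "norm (f x) / norm x \<le> \<bar>K\<bar>"
      by (cases "x = 0") (auto intro: order_trans)
  qed
  then show ?thesis
    unfolding onorm_on_def using x by (intro cSUP_upper)
qed

lemma onorm_on_bound:
  assumes f: "bounded_linear_on S f" and x: "x \<in> S"
  shows "norm (f x) \<le> onorm_on S f * norm x"
proof (cases "x = 0")
  case True
  then show ?thesis using f x unfolding bounded_linear_on_def by fastforce
next
  case False
  then show ?thesis using onorm_on_upper[OF f x] by (simp add: pos_divide_le_eq)
qed

lemma onorm_on_nonneg:
  assumes "subspace S" "bounded_linear_on S f"
  shows "0 \<le> onorm_on S f"
  using onorm_on_upper[OF assms(2) subspace_0[OF assms(1)]] by simp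

context
  fixes X :: "'a::real_normed_vector set" and \<Gamma> :: "'a \<Rightarrow> 'a \<Rightarrow> 'y::real_normed_vector \<Rightarrow> real"
  assumes G: "bounded_trilinear_form X \<Gamma>"
begin

lemma trilinear_norm_upper:
  assumes "x \<in> X" "w \<in> X"
  shows "\<bar>\<Gamma> x w y\<bar> / (norm x * norm w * norm y) \<le> trilinear_norm X \<Gamma>"
proof -
  obtain K where K: "\<And>x w (y::'y). x \<in> X \<Longrightarrow> w \<in> X \<Longrightarrow> \<bar>\<Gamma> x w y\<bar> \<le> K * norm x * norm w * norm y"
    using G unfolding bounded_trilinear_form_def by blast
  have "bdd_above ((\<lambda>(x, w, y). \<bar>\<Gamma> x w y\<bar> / (norm x * norm w * norm y)) ` (X \<times> X \<times> UNIV))"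
  proof (rule bdd_aboveI2, clarify)
    fix x w and y :: 'y assume xw: "x \<in> X" "w \<in> X"
    have "\<bar>\<Gamma> x w y\<bar> / (norm x * norm w * norm y) \<le> K" if "norm x * norm w * norm y > 0"
      using K[OF xw, of y] that by (simp add: pos_divide_le_eq mult.assoc)
    moreover have "\<bar>\<Gamma> x w y\<bar> / (norm x * norm w * norm y) = 0"
      if "\<not> norm x * norm w * norm y > 0"
      using that by (auto simp: zero_less_mult_iff)
    ultimately show "\<bar>\<Gamma> x w y\<bar> / (norm x * norm w * norm y) \<le> \<bar>K\<bar>"
      by linarith
  qed
  from cSUP_upper[OF _ this, of "(x, w, y)"] show ?thesis
    using assms by (simp add: trilinear_norm_def)
qed

lemma trilinear_norm_nonneg:
  assumes "subspace X"
  shows "0 \<le> trilinear_norm X \<Gamma>"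
  using trilinear_norm_upper[of 0 0] subspace_0[OF assms] by simp

lemma trilinear_norm_bound:
  assumes "x \<in> X" "w \<in> X"
  shows "\<bar>\<Gamma> x w y\<bar> \<le> trilinear_norm X \<Gamma> * norm x * norm w * norm y"
proof (cases "norm x * norm w * norm y = 0")
  case True
  \<comment> \<open>Here the quotient is \<open>0\<close> whatever its numerator, so
    \<open>\<Gamma> x w y = 0\<close> has to come from boundedness of the form itself.\<close>
  obtain K where "\<bar>\<Gamma> x w y\<bar> \<le> K * norm x * norm w * norm y"
    using G assms unfolding bounded_trilinear_form_def by blast
  with True show ?thesis by auto
next
  case False
  then have "0 < norm x * norm w * norm y" by (simp add: zero_less_mult_iff)
  with trilinear_norm_upper[OF assms, of y] show ?thesis
    by (simp add: pos_divide_le_eq mult.assoc)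
qed

lemma norm_Blinfun_form_le:
  assumes "subspace X" "x \<in> X" "w \<in> X"
  shows "norm (Blinfun (\<Gamma> x w)) \<le> trilinear_norm X \<Gamma> * norm x * norm w"
  using trilinear_norm_bound[of x w] trilinear_norm_nonneg assms
  by (intro norm_blinfun_bound) (auto simp: blinfun_apply_form[OF G])

text \<open>Ensures that the unit sphere of the second space is nonempty, so that suprema over it
  are meaningful: if \<open>0\<close> were the only \<open>y\<close>, all quotients would be
  \<open>0\<close>.\<close>

lemma trilinear_norm_nonzero_ex:
  assumes X: "subspace X" and "trilinear_norm X \<Gamma> \<noteq> 0"
  shows "\<exists>y::'y. y \<noteq> 0"
proof (rule ccontr)
  assume "\<not> ?thesis"
  then have "(\<lambda>(x, w, y). \<bar>\<Gamma> x w y\<bar> / (norm x * norm w * norm y)) ` (X \<times> X \<times> UNIV)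
      = (\<lambda>_. 0) ` (X \<times> X \<times> (UNIV :: 'y set))"
    by (intro image_cong) auto
  also have "\<dots> = {0}" using subspace_0[OF X] by auto
  finally show False using assms(2) unfolding trilinear_norm_def by simp
qed

end

text \<open>By homogeneity it suffices to treat the unit vector \<open>z\<close> in direction
  \<open>x\<close>, where the supremum over unit \<open>y\<close> is at most the dual norm.\<close>

lemma inf_sup_const_lower_bound:
  fixes D :: "'a::real_normed_vector \<Rightarrow> ('y::real_normed_vector \<Rightarrow>\<^sub>L real)"
  assumes X: "subspace X" and D: "linear_on X D" and Y: "\<exists>y::'y. y \<noteq> 0" and x: "x \<in> X"
  shows "inf_sup_const X D * norm x \<le> norm (D x)"
proof (cases "x = 0")
  case False
  define s where "s x = (SUP y\<in>{y. norm y = 1}. blinfun_apply (D x) y)" for x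
  obtain y0 :: 'y where y0: "y0 \<noteq> 0" using Y by blast
  define y1 where "y1 = (1 / norm y0) *\<^sub>R y0"
  have y1: "norm y1 = 1" using y0 by (simp add: y1_def)
  have le: "blinfun_apply (D x) y \<le> norm (D x)" if "norm y = 1" for x y
    using norm_blinfun[of "D x" y] that by auto
  have up: "blinfun_apply (D x) y \<le> s x" if "norm y = 1" for x y
    unfolding s_def using that le by (intro cSUP_upper bdd_aboveI2) auto
  \<comment> \<open>The sphere is symmetric, so \<open>s x\<close> dominates a value and its
    negative. The bound \<open>0\<close> then makes the infimum over \<open>x\<close> a true lower
    bound.\<close>
  have s0: "0 \<le> s x" for x
    using up[of y1 x] up[of "- y1" x] y1 by (simp add: blinfun.minus_right)
  define z where "z = (1 / norm x) *\<^sub>R x"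
  have z: "z \<in> {x \<in> X. norm x = 1}"
    using False x X by (auto simp: z_def intro: subspace_scale)
  have "inf_sup_const X D \<le> s z"
    unfolding inf_sup_const_def s_def[symmetric] using z s0
    by (intro cINF_lower bdd_belowI2) auto
  also have "s z \<le> norm (D z)"
    unfolding s_def using y1 le by (intro cSUP_least) auto
  also have "D z = (1 / norm x) *\<^sub>R D x"
    using D x unfolding z_def linear_on_def by blast
  finally show ?thesis using False by (simp add: divide_simps)
qed simp

theorem theorem3p4:
  fixes X Xh :: "'a::banach set"
    and A :: "'a \<Rightarrow> ('y::banach \<Rightarrow>\<^sub>L real)"
    and F :: "'y \<Rightarrow>\<^sub>L real"
    and \<Gamma> :: "'a \<Rightarrow> 'a \<Rightarrow> 'y \<Rightarrow> real"
    and Q :: "'a \<Rightarrow> 'a"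
    and \<Lambda>\<^sub>4 \<beta> :: real
    and u v\<^sub>h :: 'a
  assumes "subspace X" and "complete X"
    and "subspace Xh" and "complete Xh"
    and "bounded_linear_on X A"
    and "bounded_trilinear_form X \<Gamma>" and "trilinear_norm X \<Gamma> \<noteq> 0"
    and "bounded_linear_on Xh Q" and "Q ` Xh \<subseteq> X"
    and "0 \<le> \<Lambda>\<^sub>4"
    and "\<And>x\<^sub>h. x\<^sub>h \<in> Xh \<Longrightarrow> norm (x\<^sub>h - Q x\<^sub>h) \<le> \<Lambda>\<^sub>4 * infdist x\<^sub>h X"
    and "regular_solution X A F \<Gamma> u"
    and "\<beta> = inf_sup_const X (quad_deriv A \<Gamma> u)"
    and "v\<^sub>h \<in> Xh"
    and "norm (u - Q v\<^sub>h) < \<beta> / trilinear_norm X \<Gamma>"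
  shows "norm (u - v\<^sub>h) \<le>
           norm (quad_map A F \<Gamma> (Q v\<^sub>h)) / (\<beta> - trilinear_norm X \<Gamma> * norm (u - Q v\<^sub>h))
           + norm (Q v\<^sub>h - v\<^sub>h)
       \<and> norm (Q v\<^sub>h - v\<^sub>h) \<le> \<Lambda>\<^sub>4 * norm (u - v\<^sub>h)
       \<and> norm (quad_map A F \<Gamma> (Q v\<^sub>h)) \<le>
           (1 + \<Lambda>\<^sub>4) * (onorm_on X (quad_deriv A \<Gamma> u) + \<beta>) * norm (u - v\<^sub>h)"
proof -
  note X = \<open>subspace X\<close> and \<Gamma> = \<open>bounded_trilinear_form X \<Gamma>\<close>
  define G where "G = trilinear_norm X \<Gamma>"
  define D where "D = quad_deriv A \<Gamma> u"
  define e where "e = Q v\<^sub>h - u"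
  define N where "N = norm (quad_map A F \<Gamma> (Q v\<^sub>h))"
  have uX: "u \<in> X" and Nu: "quad_map A F \<Gamma> u = 0" and D: "bounded_linear_on X D"
    using \<open>regular_solution X A F \<Gamma> u\<close>
    by (auto simp: regular_solution_def invertible_on_def D_def)
  have eX: "e \<in> X"
    using \<open>Q ` Xh \<subseteq> X\<close> \<open>v\<^sub>h \<in> Xh\<close> uX X by (auto simp: e_def intro: subspace_diff)
  have G0: "0 < G"
    using trilinear_norm_nonneg[OF \<Gamma> X] \<open>trilinear_norm X \<Gamma> \<noteq> 0\<close> by (simp add: G_def)
  have Ge: "G * norm e < \<beta>"
    using assms(15) G0 by (simp add: e_def G_def norm_minus_commute pos_less_divide_eq mult.commute)
  have "quad_map A F \<Gamma> (u + e) = D e + Blinfun (\<Gamma> e e)"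
    using quad_map_expansion[OF X _ \<Gamma> uX eX, of A F] \<open>bounded_linear_on X A\<close> Nu
    by (simp add: bounded_linear_on_def D_def)
  then have exp: "quad_map A F \<Gamma> (Q v\<^sub>h) = D e + Blinfun (\<Gamma> e e)"
    by (simp add: e_def)
  have quad: "norm (Blinfun (\<Gamma> e e)) \<le> G * norm e * norm e"
    unfolding G_def by (rule norm_Blinfun_form_le[OF \<Gamma> X eX eX])
  have "\<beta> * norm e \<le> norm (D e)"
    using inf_sup_const_lower_bound[OF X _ _ eX, of D] D
      trilinear_norm_nonzero_ex[OF \<Gamma> X \<open>trilinear_norm X \<Gamma> \<noteq> 0\<close>]
      \<open>\<beta> = inf_sup_const X (quad_deriv A \<Gamma> u)\<close>
    by (simp add: bounded_linear_on_def D_def)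
  \<comment> \<open>Reverse use of the expansion: \<open>D e\<close> is the residual minus the
    quadratic term.\<close>
  also have "norm (D e) \<le> N + norm (Blinfun (\<Gamma> e e))"
    using norm_triangle_ineq4[of "quad_map A F \<Gamma> (Q v\<^sub>h)" "Blinfun (\<Gamma> e e)"]
    by (simp add: exp N_def)
  finally have "norm e * (\<beta> - G * norm e) \<le> N"
    using quad by (simp add: algebra_simps)
  then have lower: "norm e \<le> N / (\<beta> - G * norm e)"
    using Ge by (simp add: pos_le_divide_eq)
  have err: "norm (u - v\<^sub>h) \<le> norm e + norm (Q v\<^sub>h - v\<^sub>h)"
    using norm_triangle_ineq[of "u - Q v\<^sub>h" "Q v\<^sub>h - v\<^sub>h"] by (simp add: e_def norm_minus_commute)
  have "norm (Q v\<^sub>h - v\<^sub>h) \<le> \<Lambda>\<^sub>4 * infdist v\<^sub>h X"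
    using assms(11)[OF \<open>v\<^sub>h \<in> Xh\<close>] by (simp add: norm_minus_commute)
  also have "\<dots> \<le> \<Lambda>\<^sub>4 * norm (u - v\<^sub>h)"
    using infdist_le[OF uX, of v\<^sub>h] \<open>0 \<le> \<Lambda>\<^sub>4\<close>
    by (intro mult_left_mono) (auto simp: dist_norm norm_minus_commute)
  finally have smooth: "norm (Q v\<^sub>h - v\<^sub>h) \<le> \<Lambda>\<^sub>4 * norm (u - v\<^sub>h)" .
  \<comment> \<open>The other direction of the triangle inequality; with \<open>smooth\<close> it
    yields the factor \<open>1 + \<Lambda>\<^sub>4\<close>.\<close>
  have "norm e \<le> norm (u - v\<^sub>h) + norm (Q v\<^sub>h - v\<^sub>h)"
    using norm_triangle_ineq[of "Q v\<^sub>h - v\<^sub>h" "v\<^sub>h - u"] by (simp add: e_def norm_minus_commute)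
  with smooth have e_le: "norm e \<le> (1 + \<Lambda>\<^sub>4) * norm (u - v\<^sub>h)"
    by (simp add: algebra_simps)
  \<comment> \<open>The sign of \<open>\<beta>\<close> follows from the smallness assumption in the
    form \<open>Ge\<close>.\<close>
  have "0 \<le> G * norm e" using G0 by simp
  with Ge have \<beta>: "0 \<le> \<beta>" by linarith
  have "N \<le> norm (D e) + norm (Blinfun (\<Gamma> e e))"
    unfolding N_def exp by (rule norm_triangle_ineq)
  also have "\<dots> \<le> onorm_on X D * norm e + \<beta> * norm e"
  proof (rule add_mono[OF onorm_on_bound[OF D eX]])
    \<comment> \<open>One factor \<open>G * norm e\<close> is absorbed into \<open>\<beta>\<close>,
      which makes the quadratic term linear in \<open>norm e\<close>.\<close>
    show "norm (Blinfun (\<Gamma> e e)) \<le> \<beta> * norm e"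
      using quad by (rule order_trans) (use Ge in \<open>simp add: mult_right_mono\<close>)
  qed
  also have "\<dots> = (onorm_on X D + \<beta>) * norm e" by (simp add: distrib_right)
  also have "\<dots> \<le> (onorm_on X D + \<beta>) * ((1 + \<Lambda>\<^sub>4) * norm (u - v\<^sub>h))"
    using e_le onorm_on_nonneg[OF X D] \<beta> by (intro mult_left_mono) auto
  finally have "N \<le> (1 + \<Lambda>\<^sub>4) * (onorm_on X D + \<beta>) * norm (u - v\<^sub>h)"
    by (simp add: mult_ac)
  moreover have "norm (u - v\<^sub>h) \<le> N / (\<beta> - G * norm e) + norm (Q v\<^sub>h - v\<^sub>h)"
    using err lower by linarith
  ultimately show ?thesis
    using smooth by (simp add: N_def D_def G_def e_def norm_minus_commute)
qed

end
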